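(* $\mathsf{PWPP}$ is not closed under adaptive Turing reductions in the black-box setting. That is, there exists a black-box total search problem $R=(R_n)_{n}$ that is black-box adaptively Turing reducible to $\mathrm{Collision}$ but is not black-box many-one reducible to $\mathrm{Collision}$.
   Context: $\mathrm{Collision}_m$ (for $m\ge1$): an instance is a function $C\colon\{0,1\}^m\to\{0,1\}^{m-1}$ (given by its truth table); a solution is a pair $w_1\ne w_2\in\{0,1\}^m$ with $C(w_1)=C(w_2)$. $\mathsf{PWPP}$ is the class of total search problems many-one reducible to $\mathrm{Collision}$; here the black-box (decision-tree) version is meant. Black-box total search problem: a sequence $R=(R_n)_{n\ge1}$, where the instances of $R_n$ are tables $I$ of finitely many entries (at most $2^{\mathrm{poly}(n)}$ entries, each entry taking values in a set of size at most $2^{\mathrm{poly}(n)}$; all tables of the given format are instances), candidate solutions come from a finite set $O_n$ of size at most $2^{\mathrm{poly}(n)}$, every instance has at least one solution, and for each candidate $o\in O_n$ a decision tree of depth $\mathrm{poly}(n)$ decides whether $o$ is a solution of $I$. A decision tree over $I$ queries one table entry at each internal node, branches on the answer, and has outputs at its leaves; its depth is the maximum number of queries on a root-to-leaf path. Black-box many-one reduction of $R$ to $\mathrm{Collision}$: there are polynomially bounded functions $d,m\colon\mathbb{N}\to\mathbb{N}$, with $m(n)\ge1$, such that for every $n$ there are decision trees $(T_w)_{w\in\{0,1\}^{m(n)}}$ and $(D_{w_1,w_2})_{w_1\ne w_2\in\{0,1\}^{m(n)}}$ of depth at most $d(n)$ over instances $I$ of $R_n$, where $T_w$ outputs a value $C^{I}(w)\in\{0,1\}^{m(n)-1}$,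 $D_{w_1,w_2}$ outputs an element of $O_n$, and for every instance $I$ and all $w_1\neq w_2$ with $C^I(w_1)=C^I(w_2)$, the output $D_{w_1,w_2}(I)$ is a solution of $I$. Black-box adaptive Turing reduction of $R$ to $\mathrm{Collision}$: there is a polynomial $p$ such that for every $n$ there is a procedure (a decision tree with additional oracle-call nodes) making at most $p(n)$ steps on every path, each step being either a query to an entry of $I$ or a call to a $\mathrm{Collision}$ oracle. A call is specified, depending on the answers received so far, by some $m\le p(n)$ and a family $(T_w)_{w\in\{0,1\}^m}$ of decision trees over $I$ of depth at most $p(n)$ with outputs in $\{0,1\}^{m-1}$; the oracle answers with an arbitrary pair $w_1\ne w_2$ with $T_{w_1}(I)=T_{w_2}(I)$. For every instance $I$ of $R_n$ and all valid oracle answers, the output must be a solution of $I$. *)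

theory Defs
  imports "HOL-Library.FuncSet" "HOL-Computational_Algebra.Polynomial"
begin

section \<open>Black-box total search problems\<close>

text \<open>
  One member \<open>R\<^sub>n\<close> of a black-box search problem. The entry positions, the values of the
  individual entries and the candidate solutions form finite sets, and are coded as natural
  numbers.
\<close>

record search_problem =
  entries :: "nat set"
  alphabet :: "nat \<Rightarrow> nat set"
  candidates :: "nat set"
  accepts :: "(nat \<Rightarrow> nat) \<Rightarrow> nat \<Rightarrow> bool"

definition instances :: "search_problem \<Rightarrow> (nat \<Rightarrow> nat) set" where
  "instances P = (\<Pi>\<^sub>E i\<in>entries P. alphabet P i)"

definition solutions :: "search_problem \<Rightarrow> (nat \<Rightarrow> nat) \<Rightarrow> nat set" where
  "solutions P I = {s \<in> candidates P. accepts P I s}"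

datatype 'o dtree = Leaf 'o | Query nat "nat \<Rightarrow> 'o dtree"

primrec run_dtree :: "(nat \<Rightarrow> nat) \<Rightarrow> 'o dtree \<Rightarrow> 'o" where
  "run_dtree I (Leaf s) = s"
| "run_dtree I (Query i f) = run_dtree I (f (I i))"

text \<open>
  A \<open>Query\<close> node formally has a child for every natural number; only the children for values in
  the alphabet of the queried entry belong to the decision tree. The set \<open>S\<close> contains the
  permitted leaf labels.
\<close>

primrec wf_dtree :: "search_problem \<Rightarrow> 'o set \<Rightarrow> 'o dtree \<Rightarrow> bool" where
  "wf_dtree P S (Leaf s) \<longleftrightarrow> s \<in> S"
| "wf_dtree P S (Query i f) \<longleftrightarrow>
     i \<in> entries P \<and> (\<forall>a\<in>alphabet P i. wf_dtree P S (f a))"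

text \<open>
  \<open>Max\<close> is meaningful here because \<open>depth\<close> is only applied to well-formed trees, over entries with
  finite non-empty alphabets. The same holds for \<open>steps\<close> below.
\<close>

primrec depth :: "search_problem \<Rightarrow> 'o dtree \<Rightarrow> nat" where
  "depth P (Leaf s) = 0"
| "depth P (Query i f) = Suc (Max ((\<lambda>a. depth P (f a)) ` alphabet P i))"

definition total_search_problem :: "(nat \<Rightarrow> search_problem) \<Rightarrow> bool" where
  "total_search_problem R \<longleftrightarrow> (\<exists>q :: nat poly. \<forall>n\<ge>1.
     finite (entries (R n)) \<and> card (entries (R n)) \<le> 2 ^ poly q n \<and>
     (\<forall>i\<in>entries (R n). finite (alphabet (R n) i) \<and> alphabet (R n) i \<noteq> {} \<and>
        card (alphabet (R n) i) \<le> 2 ^ poly q n) \<and>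
     finite (candidates (R n)) \<and> card (candidates (R n)) \<le> 2 ^ poly q n \<and>
     (\<forall>I\<in>instances (R n). solutions (R n) I \<noteq> {}) \<and>
     (\<forall>s\<in>candidates (R n). \<exists>V :: bool dtree.
        wf_dtree (R n) UNIV V \<and> depth (R n) V \<le> poly q n \<and>
        (\<forall>I\<in>instances (R n). run_dtree I V \<longleftrightarrow> s \<in> solutions (R n) I)))"

section \<open>The problem Collision\<close>

definition bits :: "nat \<Rightarrow> bool list set" where
  "bits m = {w. length w = m}"

definition distinct_pairs :: "nat \<Rightarrow> (bool list \<times> bool list) set" where
  "distinct_pairs m = {(w1, w2). w1 \<in> bits m \<and> w2 \<in> bits m \<and> w1 \<noteq> w2}"

text \<open>
  The solutions of the Collision instance \<open>C\<close>, which is a map from \<open>bits m\<close> to \<open>bits (m - 1)\<close>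
  with \<open>m \<ge> 1\<close>; these conditions are imposed wherever an instance is formed. (For \<open>m = 0\<close>
  there would be no solutions.)
\<close>

definition collisions :: "nat \<Rightarrow> (bool list \<Rightarrow> bool list) \<Rightarrow> (bool list \<times> bool list) set" where
  "collisions m C = {(w1, w2) \<in> distinct_pairs m. C w1 = C w2}"

definition collision_family :: "search_problem \<Rightarrow> nat \<Rightarrow> nat \<Rightarrow> (bool list \<Rightarrow> bool list dtree) \<Rightarrow> bool"
  where
  "collision_family P d m T \<longleftrightarrow>
     m \<ge> 1 \<and> (\<forall>w\<in>bits m. wf_dtree P (bits (m - 1)) (T w) \<and> depth P (T w) \<le> d)"

section \<open>Many-one reductions to Collision\<close>

definition poly_bounded :: "(nat \<Rightarrow> nat) \<Rightarrow> bool" where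
  "poly_bounded f \<longleftrightarrow> (\<exists>q :: nat poly. \<forall>n\<ge>1. f n \<le> poly q n)"

definition many_one_reducible_to_Collision :: "(nat \<Rightarrow> search_problem) \<Rightarrow> bool" where
  "many_one_reducible_to_Collision R \<longleftrightarrow>
     (\<exists>d m. poly_bounded d \<and> poly_bounded m \<and>
       (\<forall>n\<ge>1. \<exists>(T :: bool list \<Rightarrow> bool list dtree) (D :: bool list \<Rightarrow> bool list \<Rightarrow> nat dtree).
          collision_family (R n) (d n) (m n) T \<and>
          (\<forall>(w1, w2)\<in>distinct_pairs (m n).
             wf_dtree (R n) (candidates (R n)) (D w1 w2) \<and> depth (R n) (D w1 w2) \<le> d n) \<and>
          (\<forall>I\<in>instances (R n). \<forall>(w1, w2)\<in>collisions (m n) (\<lambda>w. run_dtree I (T w)).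
             run_dtree I (D w1 w2) \<in> solutions (R n) I)))"

section \<open>Adaptive Turing reductions to Collision\<close>

datatype oracle_proc =
    Output nat
  | Read nat "nat \<Rightarrow> oracle_proc"
  | Call nat "bool list \<Rightarrow> bool list dtree" "bool list \<times> bool list \<Rightarrow> oracle_proc"

primrec wf_proc :: "search_problem \<Rightarrow> nat \<Rightarrow> oracle_proc \<Rightarrow> bool" where
  "wf_proc P b (Output s) \<longleftrightarrow> True"
| "wf_proc P b (Read i f) \<longleftrightarrow> i \<in> entries P \<and> (\<forall>a\<in>alphabet P i. wf_proc P b (f a))"
| "wf_proc P b (Call m T f) \<longleftrightarrow>
     m \<le> b \<and> collision_family P b m T \<and> (\<forall>r\<in>distinct_pairs m. wf_proc P b (f r))"

primrec steps :: "search_problem \<Rightarrow> oracle_proc \<Rightarrow> nat" where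
  "steps P (Output s) = 0"
| "steps P (Read i f) = Suc (Max ((\<lambda>a. steps P (f a)) ` alphabet P i))"
| "steps P (Call m T f) = Suc (Max ((\<lambda>r. steps P (f r)) ` distinct_pairs m))"

text \<open>The set of outputs on the table \<open>I\<close>, over all valid choices of the oracle answers.\<close>

primrec outputs :: "(nat \<Rightarrow> nat) \<Rightarrow> oracle_proc \<Rightarrow> nat set" where
  "outputs I (Output s) = {s}"
| "outputs I (Read i f) = outputs I (f (I i))"
| "outputs I (Call m T f) = (\<Union>r\<in>collisions m (\<lambda>w. run_dtree I (T w)). outputs I (f r))"

definition Turing_reducible_to_Collision :: "(nat \<Rightarrow> search_problem) \<Rightarrow> bool" where
  "Turing_reducible_to_Collision R \<longleftrightarrow>
     (\<exists>p :: nat poly. \<forall>n\<ge>1. \<exists>\<P>.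
        wf_proc (R n) (poly p n) \<P> \<and> steps (R n) \<P> \<le> poly p n \<and>
        (\<forall>I\<in>instances (R n). outputs I \<P> \<subseteq> solutions (R n) I))"

end

theory Submission
  imports "HOL-Library.Countable" Defs
begin

text \<open>
  \<open>R\<close> is nested Collision: a table \<open>C\<close> together with one further table \<open>E\<^sub>u\<^sub>v\<close> for each pair
  \<open>u, v\<close>; a solution is a collision \<open>u, v\<close> of \<open>C\<close> with a collision of \<open>E\<^sub>u\<^sub>v\<close>. Two oracle calls
  solve it. In a many-one reduction, a single shallow tree \<open>T\<^sub>w\<close> on a random table almost never
  queries an \<open>E\<^sub>u\<^sub>v\<close> with \<open>C u = C v\<close>, because it would have to guess a collision. Hence for some
  table more than half of the \<open>w\<close> have this property, and two of those collide. That collision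
  persists if all \<open>E\<^sub>u\<^sub>v\<close> with \<open>C u = C v\<close> are refilled, and an adversary refills them so that the
  shallow tree which must turn the collision into a solution sees only distinct values there.
\<close>

section \<open>Decision trees\<close>

primrec queried :: "(nat \<Rightarrow> nat) \<Rightarrow> 'o dtree \<Rightarrow> nat set" where
  "queried I (Leaf s) = {}"
| "queried I (Query i f) = insert i (queried I (f (I i)))"

text \<open>Lets queries that depend on the output follow a tree. It serves to append to
  \<open>D w1 w2\<close> reads of the entries that its answer names.\<close>

primrec bind_dtree :: "'o dtree \<Rightarrow> ('o \<Rightarrow> 'p dtree) \<Rightarrow> 'p dtree" where
  "bind_dtree (Leaf s) g = g s"
| "bind_dtree (Query i f) g = Query i (\<lambda>a. bind_dtree (f a) g)"

text \<open>The companions \<open>g i\<close> and \<open>h i\<close> are read before each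
  \<open>i\<close> and their answers discarded. With suitable \<open>g\<close> and \<open>h\<close>,
  a query to \<open>E\<^sub>u\<^sub>v\<close> comes with reads of \<open>C u\<close> and
  \<open>C v\<close>, so that hitting a collision of \<open>C\<close> shows as a repeated value
  among the entries read.\<close>

primrec touch :: "(nat \<Rightarrow> nat) \<Rightarrow> (nat \<Rightarrow> nat) \<Rightarrow> 'o dtree \<Rightarrow> 'o dtree" where
  "touch g h (Leaf s) = Leaf s"
| "touch g h (Query i f) =
     Query (g i) (\<lambda>_. Query (h i) (\<lambda>_. Query i (\<lambda>a. touch g h (f a))))"

lemma run_dtree_cong:
  "(\<And>i. i \<in> queried I T \<Longrightarrow> J i = I i) \<Longrightarrow> run_dtree J T = run_dtree I T"
  by (induction T) auto

lemma run_dtree_in: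
  "wf_dtree P S T \<Longrightarrow> I \<in> instances P \<Longrightarrow> run_dtree I T \<in> S"
  by (induction T) (auto simp: instances_def PiE_def Pi_def)

lemma run_bind_dtree: "run_dtree I (bind_dtree T g) = run_dtree I (g (run_dtree I T))"
  by (induction T) auto

lemma queried_bind_dtree:
  "queried I (bind_dtree T g) = queried I T \<union> queried I (g (run_dtree I T))"
  by (induction T) auto

lemma wf_bind_dtree:
  "wf_dtree P S T \<Longrightarrow> (\<And>s. s \<in> S \<Longrightarrow> wf_dtree P S' (g s)) \<Longrightarrow> wf_dtree P S' (bind_dtree T g)"
  by (induction T) auto

lemma run_touch [simp]: "run_dtree I (touch g h T) = run_dtree I T"
  by (induction T) auto

lemma queried_touch: "i \<in> queried I T \<Longrightarrow> {g i, h i} \<subseteq> queried I (touch g h T)"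
  by (induction T) auto

lemma wf_touch:
  assumes "\<And>i. i \<in> entries P \<Longrightarrow> g i \<in> entries P \<and> h i \<in> entries P"
  shows "wf_dtree P S T \<Longrightarrow> wf_dtree P S (touch g h T)"
  using assms by (induction T) auto

lemma finite_bits: "finite (bits k)"
  using finite_lists_length_eq[of "UNIV :: bool set" k] by (simp add: bits_def)

lemma card_bits: "card (bits k) = 2 ^ k"
  using card_lists_length_eq[of "UNIV :: bool set" k] by (simp add: bits_def)

text \<open>With one common alphabet, a fresh entry of a random table is uniform on
  \<open>A\<close>, so it repeats one of k earlier values with probability at most k /
  \<open>card A\<close>.\<close>

locale uniform_table =
  fixes P :: search_problem and A :: "nat set"
  assumes finite_entries: "finite (entries P)"
    and alphabet_eq: "i \<in> entries P \<Longrightarrow> alphabet P i = A"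
    and finite_A: "finite A"
    and A_nonempty: "A \<noteq> {}"
begin

lemma instances_eq: "instances P = entries P \<rightarrow>\<^sub>E A"
  unfolding instances_def using alphabet_eq by (intro PiE_cong) auto

text \<open>The maximum ranges over a finite non-empty set, so a depth bound is a bound for every
  child. The inductions below use this form in place of \<open>Max\<close>.\<close>

lemma depth_Query_le_iff:
  assumes "i \<in> entries P"
  shows "depth P (Query i f) \<le> d \<longleftrightarrow> (\<exists>d'. d = Suc d' \<and> (\<forall>a\<in>A. depth P (f a) \<le> d'))"
  using assms finite_A A_nonempty by (cases d) (auto simp: alphabet_eq)

lemma depth_Query_le:
  assumes "i \<in> entries P" "\<And>a. a \<in> A \<Longrightarrow> depth P (f a) \<le> d"
  shows "depth P (Query i f) \<le> Suc d"
  using assms depth_Query_le_iff by blast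

lemma depth_bind_dtree:
  "wf_dtree P S T \<Longrightarrow> depth P T \<le> d \<Longrightarrow> (\<And>s. s \<in> S \<Longrightarrow> depth P (g s) \<le> e) \<Longrightarrow>
    depth P (bind_dtree T g) \<le> d + e"
proof (induction T arbitrary: d)
  case (Leaf s)
  then show ?case by (simp add: trans_le_add2)
next
  case (Query i f)
  then have i: "i \<in> entries P" by simp
  obtain d' where d': "d = Suc d'" "\<forall>a\<in>A. depth P (f a) \<le> d'"
    using Query.prems(2) depth_Query_le_iff[OF i] by blast
  have "depth P (bind_dtree (f a) g) \<le> d' + e" if "a \<in> A" for a
    using Query.IH[of "f a" d'] Query.prems d' that i by (auto simp: alphabet_eq)
  then have "depth P (bind_dtree (Query i f) g) \<le> Suc (d' + e)"
    unfolding bind_dtree.simps by (intro depth_Query_le[OF i])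
  then show ?case using d'(1) by simp
qed

lemma depth_touch:
  assumes "\<And>i. i \<in> entries P \<Longrightarrow> g i \<in> entries P \<and> h i \<in> entries P"
  shows "wf_dtree P S T \<Longrightarrow> depth P T \<le> d \<Longrightarrow> depth P (touch g h T) \<le> 3 * d"
proof (induction T arbitrary: d)
  case (Leaf s)
  then show ?case by simp
next
  case (Query i f)
  then have i: "i \<in> entries P" by simp
  obtain d' where d': "d = Suc d'" "\<forall>a\<in>A. depth P (f a) \<le> d'"
    using Query.prems(2) depth_Query_le_iff[OF i] by blast
  have "depth P (touch g h (f a)) \<le> 3 * d'" if "a \<in> A" for a
    using Query.IH[of "f a" d'] Query.prems d' that i by (auto simp: alphabet_eq)
  then have "depth P (touch g h (Query i f)) \<le> Suc (Suc (Suc (3 * d')))"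
    unfolding touch.simps using assms[OF i] i by (intro depth_Query_le) auto
  then show ?case using d'(1) by simp
qed

section \<open>Repeated values on a random table\<close>

text \<open>The event that the entries in \<open>S\<close> were read with answers
  \<open>\<sigma>\<close>; counting inside this set amounts to conditioning on it.\<close>

definition extensions :: "(nat \<Rightarrow> nat) \<Rightarrow> nat set \<Rightarrow> (nat \<Rightarrow> nat) set" where
  "extensions \<sigma> S = (\<Pi>\<^sub>E i\<in>entries P. if i \<in> S then {\<sigma> i} else A)"

lemma finite_extensions: "finite (extensions \<sigma> S)"
  unfolding extensions_def using finite_entries finite_A by (intro finite_PiE) auto

lemma card_extensions:
  assumes "S \<subseteq> entries P"
  shows "card (extensions \<sigma> S) = card A ^ card (entries P - S)"
proof -
  have "card (extensions \<sigma> S) = (\<Prod>i\<in>entries P. if i \<in> S then 1 else card A)"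
    unfolding extensions_def using finite_entries by (subst card_PiE) (auto intro!: prod.cong)
  also have "\<dots> = (\<Prod>i\<in>entries P - S. card A)"
    using finite_entries by (intro prod.mono_neutral_cong_right) auto
  finally show ?thesis by simp
qed

lemma extensions_eqD: "I \<in> extensions \<sigma> S \<Longrightarrow> S \<subseteq> entries P \<Longrightarrow> i \<in> S \<Longrightarrow> I i = \<sigma> i"
  unfolding extensions_def by (auto simp: PiE_def Pi_def split: if_splits)

lemma extensions_split:
  assumes "i \<in> entries P" "i \<notin> S"
  shows "I \<in> extensions \<sigma> S \<longleftrightarrow> I i \<in> A \<and> I \<in> extensions (\<sigma>(i := I i)) (insert i S)"
  using assms unfolding extensions_def by (auto simp: PiE_def Pi_def split: if_splits)

text \<open>A union bound as in the birthday problem: each of at most \<open>d\<close> fresh reads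
  repeats one of at most \<open>card S + d\<close> known values. \<open>S\<close> and
  \<open>\<sigma>\<close> record what has been read so far, with no repeat yet, so that the
  induction can follow a path. Denominators are cleared to stay in \<open>nat\<close>.\<close>

lemma repeats_bound:
  "wf_dtree P X T \<Longrightarrow> depth P T \<le> d \<Longrightarrow> S \<subseteq> entries P \<Longrightarrow> inj_on \<sigma> S \<Longrightarrow> \<sigma> ` S \<subseteq> A \<Longrightarrow>
    card A * card {I \<in> extensions \<sigma> S. \<not> inj_on I (S \<union> queried I T)}
      \<le> d * (card S + d) * card (extensions \<sigma> S)"
proof (induction T arbitrary: d S \<sigma>)
  case (Leaf s)
  have "inj_on I S" if "I \<in> extensions \<sigma> S" for I
    using Leaf.prems(4) extensions_eqD[OF that Leaf.prems(3)]
    by (simp cong: inj_on_cong)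
  then have "{I \<in> extensions \<sigma> S. \<not> inj_on I (S \<union> queried I (Leaf s))} = {}" by simp
  then show ?case by (simp only: card.empty mult_0_right zero_le)
next
  case (Query i f)
  then have i: "i \<in> entries P" by simp
  obtain d' where d': "d = Suc d'" "\<forall>a\<in>A. depth P (f a) \<le> d'"
    using Query.prems(2) depth_Query_le_iff[OF i] by blast
  have wf: "wf_dtree P X (f a)" if "a \<in> A" for a
    using Query.prems(1) that i by (auto simp: alphabet_eq)
  let ?bad = "{I \<in> extensions \<sigma> S. \<not> inj_on I (S \<union> queried I (Query i f))}"
  have fin_S: "finite S" using Query.prems(3) finite_entries finite_subset by blast
  show ?case
  proof (cases "i \<in> S")
    case True
    then have "\<sigma> i \<in> A" using Query.prems(5) by blast
    \<comment> \<open>A second read of a known entry returns \<open>\<sigma> i\<close> and adds no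
      value, so the induction hypothesis applies with the same \<open>S\<close>.\<close>
    have "?bad = {I \<in> extensions \<sigma> S. \<not> inj_on I (S \<union> queried I (f (\<sigma> i)))}"
      using True by (simp add: extensions_eqD[OF _ Query.prems(3) True] insert_absorb cong: conj_cong)
    then have "card A * card ?bad \<le> d' * (card S + d') * card (extensions \<sigma> S)"
      using Query.IH[OF _ wf, of "\<sigma> i" d' S \<sigma>] Query.prems d'(2) \<open>\<sigma> i \<in> A\<close> by auto
    also have "\<dots> \<le> d * (card S + d) * card (extensions \<sigma> S)"
      using d'(1) by (intro mult_le_mono) auto
    finally show ?thesis .
  next
    case False
    let ?S = "insert i S"
    \<comment> \<open>\<open>B z\<close> collects the bad tables with value \<open>z\<close> at
      \<open>i\<close>; \<open>K\<close> is the number of all tables with that value, the same for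
      every \<open>z\<close>.\<close>
    define B where "B z = {I \<in> extensions (\<sigma>(i := z)) ?S. \<not> inj_on I (?S \<union> queried I (f z))}" for z
    define K where "K = card A ^ card (entries P - ?S)"
    have card_ext: "card (extensions (\<sigma>(i := z)) ?S) = K" for z
      unfolding K_def using Query.prems(3) i by (intro card_extensions) auto
    have split: "entries P - S = insert i (entries P - ?S)" using i False by auto
    have "card (entries P - S) = Suc (card (entries P - ?S))"
      by (subst split) (simp add: finite_entries)
    then have card_ext_S: "card (extensions \<sigma> S) = card A * K"
      using card_extensions[OF Query.prems(3)] by (simp add: K_def)
    have fin_B: "finite (B z)" for z
      unfolding B_def using finite_extensions by simp
    \<comment> \<open>Values \<open>z\<close> that repeat a known one get the trivial bound
      \<open>K\<close>; there are at most \<open>card S\<close> of them. For the others the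
      induction hypothesis applies with \<open>i\<close> added to \<open>S\<close>.\<close>
    have card_B: "card A * card (B z)
        \<le> (if z \<in> \<sigma> ` S then card A * K else 0) + d' * (card S + 1 + d') * K" if "z \<in> A" for z
    proof (cases "z \<in> \<sigma> ` S")
      case True
      have "card (B z) \<le> K"
        unfolding card_ext[of z, symmetric] B_def by (intro card_mono finite_extensions) auto
      then show ?thesis using True by (simp add: trans_le_add1)
    next
      case z: False
      have "inj_on (\<sigma>(i := z)) ?S"
        using Query.prems(4) z False by (auto simp: inj_on_def)
      moreover have "(\<sigma>(i := z)) ` ?S \<subseteq> A"
        using Query.prems(5) that False by auto
      moreover have "?S \<subseteq> entries P" using Query.prems(3) i by blast
      ultimately have "card A * card (B z) \<le> d' * (card ?S + d') * K"
        unfolding B_def card_ext[of z, symmetric]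
        using Query.IH[OF rangeI wf[OF that], of d' ?S "\<sigma>(i := z)"] d'(2) that by blast
      then show ?thesis using z False fin_S by simp
    qed
    have "?bad \<subseteq> (\<Union>z\<in>A. B z)"
      using extensions_split[OF i False] unfolding B_def by auto
    then have "card ?bad \<le> card (\<Union>z\<in>A. B z)"
      using fin_B finite_A by (intro card_mono) auto
    also have "\<dots> \<le> (\<Sum>z\<in>A. card (B z))"
      using finite_A by (rule card_UN_le)
    finally have "card A * card ?bad \<le> (\<Sum>z\<in>A. card A * card (B z))"
      by (simp add: sum_distrib_left[symmetric])
    also have "\<dots> \<le> (\<Sum>z\<in>A. (if z \<in> \<sigma> ` S then card A * K else 0) + d' * (card S + 1 + d') * K)"
      by (intro sum_mono card_B)
    also have "\<dots> = card (A \<inter> \<sigma> ` S) * (card A * K) + card A * (d' * (card S + 1 + d') * K)"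
      using finite_A by (simp add: sum.distrib sum.inter_restrict[symmetric])
    also have "\<dots> \<le> card S * (card A * K) + card A * (d' * (card S + 1 + d') * K)"
      using card_image_le[OF fin_S, of \<sigma>] card_mono[of "\<sigma> ` S" "A \<inter> \<sigma> ` S"] fin_S
      by (intro add_mono mult_le_mono) auto
    also have "\<dots> = (card S + d' * (card S + 1 + d')) * (card A * K)"
      by (simp add: algebra_simps)
    \<comment> \<open>With \<open>d = d' + 1\<close> the first factor is
      \<open>card S + d' * (card S + d)\<close>, which is at most
      \<open>d * (card S + d)\<close>.\<close>
    also have "\<dots> \<le> d * (card S + d) * (card A * K)"
      using d'(1) by (intro mult_le_mono) (auto simp: algebra_simps)
    finally show ?thesis using card_ext_S by simp
  qed
qed

text \<open>On a random table each \<open>w\<close> shows a repeat with probability at most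
  \<open>d\<^sup>2 / card A\<close>, less than 1/2. By averaging, some table leaves more than half
  of the \<open>2 ^ m\<close> strings without a repeat. These outnumber the
  \<open>2 ^ (m - 1)\<close> outputs, so two of them collide.\<close>

lemma collision_without_repeats:
  assumes fam: "collision_family P d m T" and small: "2 * d\<^sup>2 < card A"
  obtains I w1 w2 where "I \<in> instances P" "(w1, w2) \<in> collisions m (\<lambda>w. run_dtree I (T w))"
    "inj_on I (queried I (T w1))" "inj_on I (queried I (T w2))"
proof -
  have ext: "extensions \<sigma> {} = instances P" for \<sigma>
    by (simp add: extensions_def instances_eq)
  have fin: "finite (instances P)" using finite_extensions[of _ "{}"] ext by simp
  have pos: "card (instances P) > 0"
    unfolding instances_eq using finite_entries finite_A A_nonempty
    by (auto simp: card_gt_0_iff PiE_eq_empty_iff intro: finite_PiE)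
  have m: "m \<ge> 1" using fam by (simp add: collision_family_def)
  define bad where "bad I w \<longleftrightarrow> \<not> inj_on I (queried I (T w))" for I w
  have bound: "card A * card {I \<in> instances P. bad I w} \<le> d\<^sup>2 * card (instances P)"
    if "w \<in> bits m" for w
    using repeats_bound[of "bits (m - 1)" "T w" d "{}"] fam that
    by (simp add: collision_family_def ext bad_def power2_eq_square)
  have "\<exists>I\<in>instances P. 2 * card {w \<in> bits m. bad I w} < 2 ^ m"
  proof (rule ccontr)
    assume "\<not> ?thesis"
    then have "(\<Sum>I\<in>instances P. 2 ^ m) \<le> (\<Sum>I\<in>instances P. 2 * card {w \<in> bits m. bad I w})"
      by (intro sum_mono) (auto simp: not_less)
    also have "\<dots> = 2 * (\<Sum>I\<in>instances P. \<Sum>w\<in>bits m. if bad I w then 1 else 0)"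
      using finite_bits by (simp add: sum_distrib_left[symmetric] sum.If_cases Int_def)
    \<comment> \<open>Counting the bad pairs \<open>(I, w)\<close> by \<open>w\<close> instead of by
      \<open>I\<close> makes \<open>bound\<close> applicable.\<close>
    also have "\<dots> = 2 * (\<Sum>w\<in>bits m. card {I \<in> instances P. bad I w})"
      using fin by (subst sum.swap) (simp add: sum.If_cases Int_def)
    finally have "card A * (2 ^ m * card (instances P))
        \<le> card A * (2 * (\<Sum>w\<in>bits m. card {I \<in> instances P. bad I w}))"
      by (simp add: mult.commute)
    also have "\<dots> = 2 * (\<Sum>w\<in>bits m. card A * card {I \<in> instances P. bad I w})"
      by (simp add: sum_distrib_left mult_ac)
    also have "\<dots> \<le> 2 * (\<Sum>w\<in>bits m. d\<^sup>2 * card (instances P))"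
      by (intro mult_le_mono2 sum_mono bound)
    also have "\<dots> = 2 * d\<^sup>2 * (2 ^ m * card (instances P))"
      by (simp add: card_bits)
    also have "\<dots> < card A * (2 ^ m * card (instances P))"
      using small pos by (intro mult_strict_right_mono) auto
    finally show False by simp
  qed
  then obtain I where I: "I \<in> instances P" "2 * card {w \<in> bits m. bad I w} < 2 ^ m" by blast
  define G where "G = {w \<in> bits m. \<not> bad I w}"
  have "bits m = G \<union> {w \<in> bits m. bad I w}" "G \<inter> {w \<in> bits m. bad I w} = {}"
    by (auto simp: G_def)
  then have "2 ^ m = card G + card {w \<in> bits m. bad I w}"
    using finite_bits[of m] card_bits[of m] card_Un_disjoint[of G "{w \<in> bits m. bad I w}"]
    by (simp add: G_def)
  then have "2 ^ m < 2 * card G" using I(2) by linarith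
  \<comment> \<open>Since \<open>m \<ge> 1\<close>, the subtraction is not truncated and there are
    exactly half as many outputs as inputs.\<close>
  moreover have "(2::nat) ^ m = 2 * 2 ^ (m - 1)" using m by (cases m) auto
  ultimately have "card (bits (m - 1)) < card G" by (simp add: card_bits)
  moreover have "(\<lambda>w. run_dtree I (T w)) ` G \<subseteq> bits (m - 1)"
    using fam run_dtree_in[OF _ I(1)] by (fastforce simp: G_def collision_family_def)
  ultimately have "\<not> inj_on (\<lambda>w. run_dtree I (T w)) G"
    using finite_bits card_inj_on_le by (metis linorder_not_less)
  then obtain w1 w2 where "w1 \<in> G" "w2 \<in> G" "w1 \<noteq> w2" "run_dtree I (T w1) = run_dtree I (T w2)"
    by (auto simp: inj_on_def)
  then show ?thesis
    using that[OF I(1), of w1 w2] by (auto simp: collisions_def distinct_pairs_def G_def bad_def)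
qed

section \<open>Adaptive refilling of part of a table\<close>

lemma adversary:
  "wf_dtree P X T \<Longrightarrow> depth P T \<le> d \<Longrightarrow> I \<in> instances P \<Longrightarrow> F \<subseteq> entries P \<Longrightarrow> S \<subseteq> F \<Longrightarrow>
    inj_on I S \<Longrightarrow> card S + d \<le> card A \<Longrightarrow>
    \<exists>J\<in>instances P. (\<forall>i. i \<notin> F - S \<longrightarrow> J i = I i) \<and> inj_on J (S \<union> F \<inter> queried J T)"
proof (induction T arbitrary: d I S)
  case (Leaf s)
  then show ?case by (intro bexI[of _ I]) auto
next
  case (Query i f)
  then have i: "i \<in> entries P" by simp
  obtain d' where d': "d = Suc d'" "\<forall>a\<in>A. depth P (f a) \<le> d'"
    using Query.prems(2) depth_Query_le_iff[OF i] by blast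
  have wf: "wf_dtree P X (f a)" if "a \<in> A" for a
    using Query.prems(1) that i by (auto simp: alphabet_eq)
  have fin_S: "finite S"
    using Query.prems(4,5) finite_entries by (meson finite_subset)
  show ?case
  proof (cases "i \<in> F - S")
    case True
    have "card (I ` S) < card A"
      using card_image_le[OF fin_S, of I] Query.prems(7) d'(1) by linarith
    then obtain z where z: "z \<in> A" "z \<notin> I ` S"
      using fin_S by (metis card_mono finite_imageI linorder_not_less subsetI)
    let ?I = "I(i := z)"
    have "?I \<in> instances P"
      using Query.prems(3) z(1) i unfolding instances_eq by (auto simp: PiE_def Pi_def extensional_def)
    moreover have "inj_on ?I (insert i S)"
      using Query.prems(6) z(2) True by (auto simp: inj_on_def)
    moreover have "card (insert i S) + d' \<le> card A"
      using Query.prems(7) d'(1) fin_S True by simp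
    moreover have "insert i S \<subseteq> F" using Query.prems(5) True by blast
    ultimately obtain J where J: "J \<in> instances P" "\<forall>j. j \<notin> F - insert i S \<longrightarrow> J j = ?I j"
        "inj_on J (insert i S \<union> F \<inter> queried J (f z))"
      using Query.IH[OF rangeI wf[OF z(1)], of d' ?I "insert i S"] Query.prems(4) z(1) d'(2)
      by blast
    \<comment> \<open>\<open>i\<close> now belongs to the fixed part, so \<open>J\<close> keeps
      \<open>z\<close> there and its run continues in \<open>f z\<close>.\<close>
    have "J i = z" using J(2) by simp
    then have "S \<union> F \<inter> queried J (Query i f) = insert i S \<union> F \<inter> queried J (f z)"
      using True by auto
    then show ?thesis using J True by (intro bexI[of _ J]) auto
  next
    case False
    have "I i \<in> A" using Query.prems(3) i unfolding instances_eq by auto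
    then obtain J where J: "J \<in> instances P" "\<forall>j. j \<notin> F - S \<longrightarrow> J j = I j"
        "inj_on J (S \<union> F \<inter> queried J (f (I i)))"
      using Query.IH[OF _ wf, of "I i" d' I S] Query.prems d' by auto
    have "J i = I i" using J(2) False by simp
    then have "S \<union> F \<inter> queried J (Query i f) = S \<union> F \<inter> queried J (f (I i))"
      using False by auto
    then show ?thesis using J by (intro bexI[of _ J]) auto
  qed
qed

end

section \<open>Nested collisions\<close>

lemma bits_nonempty: "bits k \<noteq> {}"
  using card_bits[of k] by auto

lemma finite_distinct_pairs: "finite (distinct_pairs k)"
  by (rule finite_subset[of _ "bits k \<times> bits k"]) (auto simp: distinct_pairs_def finite_bits)

text \<open>One injective coding serves for entries and candidates: \<open>[u]\<close> is the entry
  \<open>C u\<close>, \<open>[u, v, x]\<close> is entry \<open>x\<close> of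
  \<open>E\<^sub>u\<^sub>v\<close>, and \<open>[u, v, x, y]\<close> is a candidate solution.\<close>

definition cell :: "bool list list \<Rightarrow> nat" where
  "cell = to_nat"

definition cells :: "nat \<Rightarrow> nat \<Rightarrow> nat set" where
  "cells n k = cell ` {ws. set ws \<subseteq> bits (Suc n) \<and> length ws = k}"

text \<open>Values have one bit fewer than the arguments in \<open>bits (Suc n)\<close>, so
  \<open>C\<close> and each \<open>E\<^sub>u\<^sub>v\<close> are Collision instances with
  \<open>m = n + 1\<close>.\<close>

definition labels :: "nat \<Rightarrow> nat set" where
  "labels n = to_nat ` bits n"

text \<open>There is a table \<open>E\<^sub>u\<^sub>v\<close> for every ordered pair, whether or not
  it collides, because the format must not depend on the values of \<open>C\<close>.\<close>

definition nested_collision :: "nat \<Rightarrow> search_problem" where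
  "nested_collision n =
    \<lparr>entries = cells n 1 \<union> cells n 3,
     alphabet = (\<lambda>_. labels n),
     candidates = cells n 4,
     accepts = (\<lambda>I s. \<exists>u v x y. s = cell [u, v, x, y] \<and> u \<noteq> v \<and> I (cell [u]) = I (cell [v]) \<and>
       x \<noteq> y \<and> I (cell [u, v, x]) = I (cell [u, v, y]))\<rparr>"

lemma cell_eq_iff [simp]: "cell ws = cell ws' \<longleftrightarrow> ws = ws'"
  by (simp add: cell_def)

lemma cell_in_cells [simp]: "cell ws \<in> cells n k \<longleftrightarrow> set ws \<subseteq> bits (Suc n) \<and> length ws = k"
  by (auto simp: cells_def)

lemma finite_cells: "finite (cells n k)"
  unfolding cells_def by (intro finite_imageI finite_lists_length_eq finite_bits)

lemma card_cells: "card (cells n k) = 2 ^ (Suc n * k)"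
proof -
  have "card (cells n k) = card {ws. set ws \<subseteq> bits (Suc n) \<and> length ws = k}"
    unfolding cells_def by (intro card_image) (auto simp: inj_on_def)
  then show ?thesis
    by (simp only: card_lists_length_eq[OF finite_bits] card_bits power_mult)
qed

lemma finite_labels: "finite (labels n)"
  by (simp add: labels_def finite_bits)

lemma card_labels: "card (labels n) = 2 ^ n"
  unfolding labels_def by (subst card_image) (auto simp: card_bits)

lemma labels_nonempty: "labels n \<noteq> {}"
  by (simp add: labels_def bits_nonempty)

lemma entries_nested_collision:
  "cell ws \<in> entries (nested_collision n) \<longleftrightarrow>
    set ws \<subseteq> bits (Suc n) \<and> (length ws = 1 \<or> length ws = 3)"
  by (auto simp: nested_collision_def)

lemma alphabet_nested_collision [simp]: "alphabet (nested_collision n) i = labels n"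
  by (simp add: nested_collision_def)

lemma candidates_nested_collision:
  "s \<in> candidates (nested_collision n) \<longleftrightarrow> (\<exists>u v x y. s = cell [u, v, x, y] \<and>
    u \<in> bits (Suc n) \<and> v \<in> bits (Suc n) \<and> x \<in> bits (Suc n) \<and> y \<in> bits (Suc n))"
proof -
  have "length ws = 4 \<longleftrightarrow> (\<exists>u v x y. ws = [u, v, x, y])" for ws :: "bool list list"
    by (auto simp: numeral_eq_Suc length_Suc_conv)
  then show ?thesis
    by (fastforce simp: nested_collision_def cells_def)
qed

lemma solutions_nested_collision:
  "cell [u, v, x, y] \<in> solutions (nested_collision n) I \<longleftrightarrow>
    u \<in> bits (Suc n) \<and> v \<in> bits (Suc n) \<and> x \<in> bits (Suc n) \<and> y \<in> bits (Suc n) \<and>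
    u \<noteq> v \<and> I (cell [u]) = I (cell [v]) \<and> x \<noteq> y \<and> I (cell [u, v, x]) = I (cell [u, v, y])"
  by (auto simp: solutions_def nested_collision_def)

lemma instances_nested_collision:
  "I \<in> instances (nested_collision n) \<Longrightarrow> i \<in> entries (nested_collision n) \<Longrightarrow> I i \<in> labels n"
  by (auto simp: instances_def PiE_def Pi_def)

interpretation nested: uniform_table "nested_collision n" "labels n" for n
  by unfold_locales
    (simp_all add: finite_labels labels_nonempty nested_collision_def finite_cells)

section \<open>Totality and verification of solutions\<close>

lemma pigeonhole_labels:
  assumes "\<And>w. w \<in> bits (Suc n) \<Longrightarrow> g w \<in> labels n"
  obtains u v where "u \<in> bits (Suc n)" "v \<in> bits (Suc n)" "u \<noteq> v" "g u = g v"
proof -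
  have "\<not> inj_on g (bits (Suc n))"
  proof
    assume "inj_on g (bits (Suc n))"
    then have "card (bits (Suc n)) \<le> card (labels n)"
      using assms by (intro card_inj_on_le finite_labels) auto
    then show False by (simp add: card_bits card_labels)
  qed
  then show ?thesis using that by (auto simp: inj_on_def)
qed

text \<open>Pigeonhole twice: first for \<open>C\<close>, then for the table
  \<open>E\<^sub>u\<^sub>v\<close> over the collision found.\<close>

lemma nested_collision_total:
  assumes I: "I \<in> instances (nested_collision n)"
  shows "solutions (nested_collision n) I \<noteq> {}"
proof -
  note label = instances_nested_collision[OF I]
  obtain u v where uv: "u \<in> bits (Suc n)" "v \<in> bits (Suc n)" "u \<noteq> v" "I (cell [u]) = I (cell [v])"
    using pigeonhole_labels[of n "\<lambda>w. I (cell [w])"] label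
    by (metis entries_nested_collision empty_subsetI insert_subset list.set length_Cons
        list.size(3) One_nat_def)
  have "I (cell [u, v, w]) \<in> labels n" if "w \<in> bits (Suc n)" for w
    using that uv by (intro label) (simp add: entries_nested_collision)
  then obtain x y where "x \<in> bits (Suc n)" "y \<in> bits (Suc n)" "x \<noteq> y"
      "I (cell [u, v, x]) = I (cell [u, v, y])"
    using pigeonhole_labels[of n "\<lambda>w. I (cell [u, v, w])"] by blast
  then have "cell [u, v, x, y] \<in> solutions (nested_collision n) I"
    using uv by (simp add: solutions_nested_collision)
  then show ?thesis by blast
qed

lemma nested_collision_verifier:
  assumes "s \<in> candidates (nested_collision n)"
  shows "\<exists>V :: bool dtree. wf_dtree (nested_collision n) UNIV V \<and>
    depth (nested_collision n) V \<le> 4 \<and>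
    (\<forall>I\<in>instances (nested_collision n). run_dtree I V \<longleftrightarrow> s \<in> solutions (nested_collision n) I)"
proof -
  obtain u v x y where s: "s = cell [u, v, x, y]"
      and bits: "u \<in> bits (Suc n)" "v \<in> bits (Suc n)" "x \<in> bits (Suc n)" "y \<in> bits (Suc n)"
    using assms by (auto simp: candidates_nested_collision)
  define V where "V = Query (cell [u]) (\<lambda>a. Query (cell [v]) (\<lambda>b.
    Query (cell [u, v, x]) (\<lambda>c. Query (cell [u, v, y]) (\<lambda>e.
      Leaf (u \<noteq> v \<and> a = b \<and> x \<noteq> y \<and> c = e)))))"
  have "wf_dtree (nested_collision n) UNIV V"
    using bits by (simp add: V_def entries_nested_collision)
  moreover have "depth (nested_collision n) V \<le> Suc (Suc (Suc (Suc 0)))"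
    unfolding V_def using bits
    by (intro nested.depth_Query_le) (simp_all add: entries_nested_collision)
  moreover have "run_dtree I V \<longleftrightarrow> s \<in> solutions (nested_collision n) I" for I
    using bits by (simp add: V_def s solutions_nested_collision)
  ultimately show ?thesis by (auto simp: numeral_eq_Suc)
qed

lemma nested_collision_search_problem: "total_search_problem nested_collision"
  unfolding total_search_problem_def
\<comment> \<open>The polynomial is \<open>4 * (n + 1)\<close>: there are
  \<open>2 ^ (4 * (n + 1))\<close> candidates, and it also bounds the verifier depth 4.\<close>
proof (intro exI[of _ "[:4, 4:]"] allI impI)
  fix n :: nat
  let ?P = "nested_collision n" and ?q = "poly [:4, 4:] n"
  have q: "?q = Suc n * 4" by simp
  have "card (entries ?P) \<le> card (cells n 1) + card (cells n 3)"
    by (simp add: nested_collision_def card_Un_le)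
  also have "\<dots> \<le> 2 ^ (Suc n * 3) + 2 ^ (Suc n * 3)"
    unfolding card_cells by (intro add_mono power_increasing) auto
  also have "\<dots> = 2 ^ Suc (Suc n * 3)" by (simp only: power_Suc mult_2)
  also have "\<dots> \<le> 2 ^ ?q" unfolding q by (intro power_increasing) auto
  finally have "card (entries ?P) \<le> 2 ^ ?q" .
  moreover have "card (labels n) \<le> 2 ^ ?q"
    unfolding q card_labels by (intro power_increasing) auto
  moreover have "finite (candidates ?P) \<and> card (candidates ?P) \<le> 2 ^ ?q"
    unfolding q by (simp add: nested_collision_def finite_cells card_cells)
  moreover have "\<exists>V :: bool dtree. wf_dtree ?P UNIV V \<and> depth ?P V \<le> ?q \<and>
      (\<forall>I\<in>instances ?P. run_dtree I V \<longleftrightarrow> s \<in> solutions ?P I)" if s: "s \<in> candidates ?P" for s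
  proof -
    have "4 \<le> ?q" by simp
    then show ?thesis using nested_collision_verifier[OF s] order_trans by blast
  qed
  ultimately show "finite (entries ?P) \<and> card (entries ?P) \<le> 2 ^ ?q \<and>
     (\<forall>i\<in>entries ?P. finite (alphabet ?P i) \<and> alphabet ?P i \<noteq> {} \<and>
        card (alphabet ?P i) \<le> 2 ^ ?q) \<and>
     finite (candidates ?P) \<and> card (candidates ?P) \<le> 2 ^ ?q \<and>
     (\<forall>I\<in>instances ?P. solutions ?P I \<noteq> {}) \<and>
     (\<forall>s\<in>candidates ?P. \<exists>V :: bool dtree. wf_dtree ?P UNIV V \<and> depth ?P V \<le> ?q \<and>
        (\<forall>I\<in>instances ?P. run_dtree I V \<longleftrightarrow> s \<in> solutions ?P I))"
    using nested.finite_entries nested_collision_total labels_nonempty finite_labels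
    by (simp only: alphabet_nested_collision) blast
qed

section \<open>Adaptive reduction with two oracle calls\<close>

definition lookup :: "nat \<Rightarrow> bool list dtree" where
  "lookup i = Query i (\<lambda>a. Leaf (from_nat a))"

text \<open>Table values are codes of \<open>n\<close>-bit strings, and \<open>from_nat\<close> is
  injective on such codes, so decoding creates no new collisions.\<close>

lemma lookup_eqD:
  assumes "I \<in> instances (nested_collision n)" "i \<in> entries (nested_collision n)"
    "j \<in> entries (nested_collision n)" "run_dtree I (lookup i) = run_dtree I (lookup j)"
  shows "I i = I j"
  using instances_nested_collision[OF assms(1,2)] instances_nested_collision[OF assms(1,3)] assms(4)
  by (auto simp: labels_def lookup_def)

lemma collision_family_lookup:
  assumes "\<And>w. w \<in> bits (Suc n) \<Longrightarrow> h w \<in> entries (nested_collision n)" "d \<ge> 1"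
  shows "collision_family (nested_collision n) d (Suc n) (\<lambda>w. lookup (h w))"
proof -
  have "depth (nested_collision n) (lookup (h w)) \<le> Suc 0" if "w \<in> bits (Suc n)" for w
    unfolding lookup_def using assms(1)[OF that] by (intro nested.depth_Query_le) auto
  then show ?thesis
    using assms by (fastforce simp: collision_family_def lookup_def labels_def)
qed

text \<open>The first call finds a collision \<open>u, v\<close> of \<open>C\<close>; its answer
  selects the table \<open>E\<^sub>u\<^sub>v\<close> for the second call. The two answers together
  form a solution.\<close>

lemma nested_collision_Turing_reducible: "Turing_reducible_to_Collision nested_collision"
  unfolding Turing_reducible_to_Collision_def
\<comment> \<open>\<open>n + 2\<close> bounds the instance size \<open>n + 1\<close>, the lookup
  depth 1 and the 2 steps.\<close>
proof (intro exI[of _ "[:2, 1:]"] allI impI)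
  fix n :: nat
  let ?P = "nested_collision n" and ?p = "poly [:2, 1:] n"
  let ?proc = "Call (Suc n) (\<lambda>w. lookup (cell [w])) (\<lambda>(u, v).
    Call (Suc n) (\<lambda>w. lookup (cell [u, v, w])) (\<lambda>(x, y). Output (cell [u, v, x, y])))"
  have "collision_family ?P ?p (Suc n) (\<lambda>w. lookup (cell [w]))"
    by (intro collision_family_lookup) (auto simp: entries_nested_collision)
  moreover have "collision_family ?P ?p (Suc n) (\<lambda>w. lookup (cell [u, v, w]))"
    if "(u, v) \<in> distinct_pairs (Suc n)" for u v
    using that by (intro collision_family_lookup) (auto simp: entries_nested_collision distinct_pairs_def)
  ultimately have wf: "wf_proc ?P ?p ?proc" by auto
  \<comment> \<open>At least two strings exist, so \<open>Max\<close> in \<open>steps\<close> is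
    taken over a non-empty set, here a singleton.\<close>
  have "\<not> card (bits (Suc n)) \<le> Suc 0"
    using one_less_power[of "2 :: nat" "Suc n"] unfolding card_bits by simp
  then have "distinct_pairs (Suc n) \<noteq> {}"
    unfolding card_le_Suc0_iff_eq[OF finite_bits] by (auto simp: distinct_pairs_def)
  then have "(\<lambda>r. c) ` distinct_pairs (Suc n) = {c}" for c :: nat by auto
  then have "steps ?P ?proc = 2" by (simp add: case_prod_unfold)
  then have steps: "steps ?P ?proc \<le> ?p" by simp
  have "s \<in> solutions ?P I" if I: "I \<in> instances ?P" and s: "s \<in> outputs I ?proc" for I s
  proof -
    obtain u v x y where uv: "(u, v) \<in> collisions (Suc n) (\<lambda>w. run_dtree I (lookup (cell [w])))"
      and xy: "(x, y) \<in> collisions (Suc n) (\<lambda>w. run_dtree I (lookup (cell [u, v, w])))"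
      and s: "s = cell [u, v, x, y]"
      using s by auto
    have "u \<in> bits (Suc n)" "v \<in> bits (Suc n)" "u \<noteq> v"
      "x \<in> bits (Suc n)" "y \<in> bits (Suc n)" "x \<noteq> y"
      using uv xy by (auto simp: collisions_def distinct_pairs_def)
    moreover from this have "I (cell [u]) = I (cell [v])" "I (cell [u, v, x]) = I (cell [u, v, y])"
      using uv xy by (auto intro!: lookup_eqD[OF I] simp: collisions_def entries_nested_collision)
    ultimately show ?thesis by (simp add: s solutions_nested_collision)
  qed
  then show "\<exists>\<P>. wf_proc ?P ?p \<P> \<and> steps ?P \<P> \<le> ?p \<and>
      (\<forall>I\<in>instances ?P. outputs I \<P> \<subseteq> solutions ?P I)"
    using wf steps by blast
qed

section \<open>Lower bound for many-one reductions\<close>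

text \<open>Otherwise both halves of the argument have room. \<open>touch\<close> at most triples
  the depth of \<open>T w\<close>, so a collision without repeats needs
  \<open>2 * (3 * d)\<^sup>2 = 18 * d\<^sup>2 < 2 ^ n\<close>. The adversary faces
  \<open>D w1 w2\<close> and two more queries, and needs \<open>d + 2 \<le> 2 ^ n\<close>.\<close>

lemma no_shallow_many_one_reduction:
  assumes fam: "collision_family (nested_collision n) d m T"
    and D: "\<And>w1 w2. (w1, w2) \<in> distinct_pairs m \<Longrightarrow>
      wf_dtree (nested_collision n) (candidates (nested_collision n)) (D w1 w2) \<and>
      depth (nested_collision n) (D w1 w2) \<le> d"
    and correct: "\<And>I w1 w2. I \<in> instances (nested_collision n) \<Longrightarrow>
      (w1, w2) \<in> collisions m (\<lambda>w. run_dtree I (T w)) \<Longrightarrow>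
      run_dtree I (D w1 w2) \<in> solutions (nested_collision n) I"
  shows "2 ^ n \<le> 18 * d\<^sup>2 + d + 2"
proof (rule ccontr)
  assume large: "\<not> ?thesis"
  let ?P = "nested_collision n"
  \<comment> \<open>For the entry \<open>[u, v, x]\<close> these are \<open>[u]\<close> and \<open>[v]\<close>, and for \<open>[u]\<close> both are \<open>[u]\<close>.\<close>
  define g where "g i = cell [hd (from_nat i)]" for i
  define h where "h i = (let ws = from_nat i in cell [ws ! (length ws div 2)])" for i
  have g [simp]: "g (cell ws) = cell [hd ws]" for ws
    by (simp add: g_def cell_def)
  have h [simp]: "h (cell ws) = cell [ws ! (length ws div 2)]" for ws
    by (simp add: h_def cell_def)
  have gh: "g i \<in> entries ?P \<and> h i \<in> entries ?P" if "i \<in> entries ?P" for i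
  proof -
    obtain ws where ws: "i = cell ws" "set ws \<subseteq> bits (Suc n)" "length ws = 1 \<or> length ws = 3"
      using \<open>i \<in> entries ?P\<close> by (auto simp: nested_collision_def cells_def)
    then have "hd ws \<in> set ws" "ws ! (length ws div 2) \<in> set ws"
      by (auto intro: hd_in_set nth_mem)
    then show ?thesis using ws by (auto simp: entries_nested_collision)
  qed
  have "collision_family ?P (3 * d) m (\<lambda>w. touch g h (T w))"
    using fam wf_touch[of ?P g h, OF gh] nested.depth_touch[of n g h, OF gh]
    unfolding collision_family_def by blast
  moreover have "2 * (3 * d)\<^sup>2 < card (labels n)"
    using large by (simp add: card_labels power_mult_distrib)
  ultimately obtain I w1 w2 where I: "I \<in> instances ?P"
      and "(w1, w2) \<in> collisions m (\<lambda>w. run_dtree I (touch g h (T w)))"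
      and inj: "inj_on I (queried I (touch g h (T w1)))" "inj_on I (queried I (touch g h (T w2)))"
    by (rule nested.collision_without_repeats)
  then have coll: "(w1, w2) \<in> collisions m (\<lambda>w. run_dtree I (T w))" by simp
  \<comment> \<open>The entries of all \<open>E\<^sub>u\<^sub>v\<close> over collisions of
    \<open>C\<close>: the part to be refilled.\<close>
  define F where "F = {cell [u, v, x] | u v x. u \<in> bits (Suc n) \<and> v \<in> bits (Suc n) \<and>
    x \<in> bits (Suc n) \<and> u \<noteq> v \<and> I (cell [u]) = I (cell [v])}"
  \<comment> \<open>A read of such an entry would be accompanied by reads of \<open>[u]\<close> and
    \<open>[v]\<close>, distinct entries with equal values, against injectivity.\<close>
  have unqueried: "i \<notin> F" if inj: "inj_on I (queried I (touch g h (T w)))"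
    and i: "i \<in> queried I (T w)" for w i
  proof
    assume "i \<in> F"
    then obtain u v x where "i = cell [u, v, x]" "u \<noteq> v" "I (cell [u]) = I (cell [v])"
      by (auto simp: F_def)
    moreover from this have "{cell [u], cell [v]} \<subseteq> queried I (touch g h (T w))"
      using queried_touch[OF i, of g h] by simp
    ultimately show False using inj_onD[OF inj, of "cell [u]" "cell [v]"] by simp
  qed
  \<comment> \<open>Once \<open>D w1 w2\<close> has answered, the two entries of
    \<open>E\<^sub>u\<^sub>v\<close> named in the answer are read as well, so that the adversary
    controls them even if \<open>D w1 w2\<close> never looked at them.\<close>
  define probe where "probe s = (let ws = from_nat s in
    Query (cell (take 3 ws)) (\<lambda>_. Query (cell (take 2 ws @ drop 3 ws)) (\<lambda>_. Leaf s)))" for s :: nat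
  have probe: "probe (cell [u, v, x, y]) =
      Query (cell [u, v, x]) (\<lambda>_. Query (cell [u, v, y]) (\<lambda>_. Leaf (cell [u, v, x, y])))" for u v x y
    by (simp add: probe_def cell_def)
  have wf_probe: "wf_dtree ?P UNIV (probe s) \<and> depth ?P (probe s) \<le> Suc (Suc 0)"
    if cand: "s \<in> candidates ?P" for s
  proof
    obtain u v x y where s: "s = cell [u, v, x, y]"
      and bits: "u \<in> bits (Suc n)" "v \<in> bits (Suc n)" "x \<in> bits (Suc n)" "y \<in> bits (Suc n)"
      using cand by (auto simp: candidates_nested_collision)
    show "wf_dtree ?P UNIV (probe s)"
      using bits by (simp add: s probe entries_nested_collision)
    show "depth ?P (probe s) \<le> Suc (Suc 0)"
      unfolding s probe using bits
      by (intro nested.depth_Query_le) (simp_all add: entries_nested_collision)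
  qed
  let ?D = "D w1 w2"
  have pair: "(w1, w2) \<in> distinct_pairs m" using coll by (simp add: collisions_def)
  have "wf_dtree ?P UNIV (bind_dtree ?D probe)"
    using wf_bind_dtree D[OF pair] wf_probe by blast
  moreover have "depth ?P (bind_dtree ?D probe) \<le> d + Suc (Suc 0)"
    using nested.depth_bind_dtree D[OF pair] wf_probe by blast
  moreover have "F \<subseteq> entries ?P" by (auto simp: F_def entries_nested_collision)
  moreover have "card {} + (d + Suc (Suc 0)) \<le> card (labels n)"
    using large by (simp add: card_labels)
  ultimately obtain J where J: "J \<in> instances ?P" "\<forall>i. i \<notin> F \<longrightarrow> J i = I i"
      "inj_on J (F \<inter> queried J (bind_dtree ?D probe))"
    using nested.adversary[of n UNIV "bind_dtree ?D probe" "d + Suc (Suc 0)" I F "{}"] I by auto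
  \<comment> \<open>\<open>J\<close> differs from \<open>I\<close> only on \<open>F\<close>, which
    the runs of both trees on \<open>I\<close> avoid.\<close>
  have "run_dtree J (T w) = run_dtree I (T w)" if "w \<in> {w1, w2}" for w
    using J(2) unqueried inj that by (intro run_dtree_cong) auto
  then have "(w1, w2) \<in> collisions m (\<lambda>w. run_dtree J (T w))"
    using coll by (simp add: collisions_def)
  then have sol: "run_dtree J ?D \<in> solutions ?P J" by (rule correct[OF J(1)])
  then obtain u v x y where s: "run_dtree J ?D = cell [u, v, x, y]"
    unfolding solutions_def candidates_nested_collision by blast
  \<comment> \<open>\<open>F\<close> contains only codes of lists of length 3, so \<open>C\<close>
    and its collisions are the same in \<open>J\<close> as in \<open>I\<close>.\<close>
  have cell_J: "J (cell [w]) = I (cell [w])" for w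
    using J(2) by (auto simp: F_def)
  note uvxy = sol[unfolded s solutions_nested_collision cell_J]
  have "{cell [u, v, x], cell [u, v, y]} \<subseteq> F"
    using uvxy by (auto simp: F_def)
  moreover have "{cell [u, v, x], cell [u, v, y]} \<subseteq> queried J (bind_dtree ?D probe)"
    by (simp add: queried_bind_dtree s probe)
  \<comment> \<open>Both entries lie in \<open>F\<close> and are read, so the adversary gave them
    different values, while the solution claims that they are equal.\<close>
  ultimately show False
    using inj_onD[OF J(3), of "cell [u, v, x]" "cell [u, v, y]"] uvxy by auto
qed

section \<open>Exponentials outgrow polynomials\<close>

text \<open>Write \<open>x ^ n\<close> as \<open>sqrt x ^ n * sqrt x ^ n\<close>: one factor absorbs
  a single \<open>n\<close>, the other the remaining power by induction. Hence the induction is over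
  all \<open>x\<close>.\<close>

lemma power_times_geometric_tendsto_0:
  fixes x :: real
  shows "0 \<le> x \<Longrightarrow> x < 1 \<Longrightarrow> (\<lambda>n. real n ^ k * x ^ n) \<longlonglongrightarrow> 0"
proof (induction k arbitrary: x)
  case 0
  then show ?case using LIMSEQ_realpow_zero[of x] by simp
next
  case (Suc k)
  have "(\<lambda>n. (real n * sqrt x ^ n) * (real n ^ k * sqrt x ^ n)) \<longlonglongrightarrow> 0 * 0"
    using Suc by (intro tendsto_mult powser_times_n_limit_0 Suc.IH) auto
  moreover have "(real n * sqrt x ^ n) * (real n ^ k * sqrt x ^ n) = real n ^ Suc k * x ^ n" for n
    using Suc.prems(1) by (simp add: mult_ac flip: power_mult_distrib)
  ultimately show ?case by simp
qed

text \<open>The extra factor \<open>n ^ k\<close> makes the induction on \<open>q\<close> work: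
  \<open>pCons a q\<close> evaluates to \<open>a + n * poly q n\<close>, which raises
  \<open>k\<close> by one.\<close>

lemma poly_over_exp_tendsto_0:
  "(\<lambda>n. real n ^ k * real (poly q n) / 2 ^ n) \<longlonglongrightarrow> 0"
proof (induction q arbitrary: k)
  case 0
  then show ?case by simp
next
  case (pCons a q)
  have "(\<lambda>n. real a * (real n ^ k * (1 / 2) ^ n) + real n ^ Suc k * real (poly q n) / 2 ^ n)
      \<longlonglongrightarrow> real a * 0 + 0"
    by (intro tendsto_add tendsto_mult tendsto_const power_times_geometric_tendsto_0 pCons.IH) auto
  then show ?case by (simp add: field_simps power_one_over)
qed

lemma poly_less_exp: "\<exists>n\<ge>1. poly q n < (2 :: nat) ^ n"
proof -
  have "\<forall>\<^sub>F n in sequentially. real (poly q n) / 2 ^ n < 1 \<and> n \<ge> 1"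
    using poly_over_exp_tendsto_0[of 0 q]
    by (intro eventually_conj eventually_ge_at_top order_tendstoD(2)) auto
  then obtain n where "real (poly q n) / 2 ^ n < 1" "n \<ge> 1"
    using eventually_happens'[OF sequentially_bot] by blast
  then have "real (poly q n) < real (2 ^ n)" by (simp add: field_simps)
  then show ?thesis using \<open>n \<ge> 1\<close> unfolding of_nat_less_iff by blast
qed

lemma nested_collision_not_many_one_reducible:
  "\<not> many_one_reducible_to_Collision nested_collision"
proof
  assume "many_one_reducible_to_Collision nested_collision"
  then obtain d m where d: "poly_bounded d"
    and red: "\<And>n. n \<ge> 1 \<Longrightarrow> \<exists>T D. collision_family (nested_collision n) (d n) (m n) T \<and>
          (\<forall>(w1, w2)\<in>distinct_pairs (m n).
             wf_dtree (nested_collision n) (candidates (nested_collision n)) (D w1 w2) \<and>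
             depth (nested_collision n) (D w1 w2) \<le> d n) \<and>
          (\<forall>I\<in>instances (nested_collision n).
             \<forall>(w1, w2)\<in>collisions (m n) (\<lambda>w. run_dtree I (T w)).
             run_dtree I (D w1 w2) \<in> solutions (nested_collision n) I)"
    unfolding many_one_reducible_to_Collision_def by blast
  have lower: "2 ^ n \<le> 18 * (d n)\<^sup>2 + d n + 2" if n: "n \<ge> 1" for n
    using red[OF n] by (elim exE conjE) (rule no_shallow_many_one_reduction, auto)
  obtain q where q: "\<And>n. n \<ge> 1 \<Longrightarrow> d n \<le> poly q n"
    using d by (auto simp: poly_bounded_def)
  \<comment> \<open>The polynomial is the lower bound on \<open>2 ^ n\<close> with \<open>q\<close>
    in place of \<open>d n\<close>; it is monotone in that argument.\<close>
  obtain n where n: "n \<ge> 1" "poly (18 * q\<^sup>2 + q + 2) n < 2 ^ n"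
    using poly_less_exp by blast
  have "18 * (d n)\<^sup>2 + d n + 2 \<le> 18 * (poly q n)\<^sup>2 + poly q n + 2"
    using q[OF n(1)] by (intro add_mono mult_le_mono power_mono) auto
  then show False using lower[OF n(1)] n(2) by simp
qed

theorem corollary14:
  "\<exists>R :: nat \<Rightarrow> search_problem.
     total_search_problem R \<and>
     Turing_reducible_to_Collision R \<and>
     \<not> many_one_reducible_to_Collision R"
  using nested_collision_search_problem nested_collision_Turing_reducible
    nested_collision_not_many_one_reducible by blast

end
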